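(* Let $f$ be a symmetric norm on $\mathbb R^n$, $\mathcal H$ a complex Hilbert space with $\dim\mathcal H\ge n$, and $\|A\|=f(s_1(A),\dots,s_n(A))$ for $A\in\mathcal B(\mathcal H)$. Suppose $\|\cdot\|$ is submultiplicative, i.e. $\|AB\|\le\|A\|\|B\|$ for all $A,B$. Then there exist nonzero $A,B\in\mathcal B(\mathcal H)$ with $\|AB\|=\|A\|\|B\|$ if and only if $\|\cdot\|$ is a cross norm (i.e. $\|A\|=s_1(A)$ for every rank one $A$). In case $\|\cdot\|$ is a cross norm: (1) two nonzero operators $A,B\in\mathcal B(\mathcal H)$ satisfy $\|AB\|=\|A\|\|B\|$ if and only if $s_1(AB)=\|A\|\|B\|$; (2) if moreover every nonzero $T\in\mathcal B(\mathcal H)$ with $\|T\|=s_1(T)$ has rank one, then two nonzero operators $A,B\in\mathcal B(\mathcal H)$ satisfy $\|AB\|=\|A\|\|B\|$ if and only if $A=xy^*$ and $B=yz^*$ for some nonzero $x,y,z\in\mathcal H$ with $\langle y,y\rangle=1$.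
   Context: $\mathcal B(\mathcal H)$ is the algebra of bounded linear operators on $\mathcal H$; $s_k(A)=\inf\{\|A-X\|_{\rm sp}:\operatorname{rank}X<k\}$ is the $k$th singular value, with $\|\cdot\|_{\rm sp}$ the operator norm. A norm $f$ on $\mathbb R^n$ is symmetric if $f(Px)=f(x)$ for all $x$ and every permutation or diagonal orthogonal matrix $P$. $xy^*$ denotes the operator $v\mapsto\langle v,y\rangle x$. *)

theory Defs
  imports "HOL-Analysis.Analysis" "HOL-Library.Extended_Nat"
begin

text \<open>Complex inner product spaces. A complex inner product space is in particular a
real inner product space with real inner product the real part of the complex one;
we build on the library class real_inner for this reason. The complex inner product
is linear in the first argument and conjugate-linear in the second.\<close>

class complex_inner = real_inner +
  fixes scaleC :: "complex \<Rightarrow> 'a \<Rightarrow> 'a" (infixr "*\<^sub>C" 75)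
  fixes cinner :: "'a \<Rightarrow> 'a \<Rightarrow> complex"
  assumes scaleC_add_right: "a *\<^sub>C (x + y) = a *\<^sub>C x + a *\<^sub>C y"
    and scaleC_add_left: "(a + b) *\<^sub>C x = a *\<^sub>C x + b *\<^sub>C x"
    and scaleC_scaleC: "a *\<^sub>C (b *\<^sub>C x) = (a * b) *\<^sub>C x"
    and scaleC_one: "1 *\<^sub>C x = x"
    and scaleR_scaleC: "scaleR r x = complex_of_real r *\<^sub>C x"
    and cinner_add_left: "cinner (x + y) z = cinner x z + cinner y z"
    and cinner_scaleC_left: "cinner (a *\<^sub>C x) y = a * cinner x y"
    and cinner_commute: "cinner x y = cnj (cinner y x)"
    and Re_cinner: "Re (cinner x y) = inner x y"

class chilbert = complex_inner + complete_space

definition bop :: "('a::complex_inner \<Rightarrow> 'a) \<Rightarrow> bool" where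
  "bop A \<longleftrightarrow> (\<forall>x y. A (x + y) = A x + A y) \<and> (\<forall>c x. A (c *\<^sub>C x) = c *\<^sub>C A x)
     \<and> (\<exists>K. \<forall>x. norm (A x) \<le> norm x * K)"

definition cspan :: "'a::complex_inner set \<Rightarrow> 'a set" where
  "cspan S = {y. \<exists>c. y = (\<Sum>s\<in>S. c s *\<^sub>C s)}"

definition cindependent :: "'a::complex_inner set \<Rightarrow> bool" where
  "cindependent S \<longleftrightarrow> (\<forall>c. (\<Sum>s\<in>S. c s *\<^sub>C s) = 0 \<longrightarrow> (\<forall>s\<in>S. c s = 0))"

text \<open>Rank of an operator (dimension of its range over the complex numbers);
infinity if the range is infinite-dimensional.\<close>
definition crank :: "('a::complex_inner \<Rightarrow> 'a) \<Rightarrow> enat" where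
  "crank X = (INF S\<in>{S. finite S \<and> range X \<subseteq> cspan S}. enat (card S))"

definition sval :: "nat \<Rightarrow> ('a::complex_inner \<Rightarrow> 'a) \<Rightarrow> real" where
  "sval k A = Inf {onorm (\<lambda>v. A v - X v) | X. bop X \<and> crank X < enat k}"

text \<open>Vectors of R^n are represented as functions nat => real vanishing from index n on
(coordinate i+1 of the paper is index i here).\<close>
definition Rn :: "nat \<Rightarrow> (nat \<Rightarrow> real) set" where
  "Rn n = {x. \<forall>i\<ge>n. x i = 0}"

definition symmetric_norm :: "nat \<Rightarrow> ((nat \<Rightarrow> real) \<Rightarrow> real) \<Rightarrow> bool" where
  "symmetric_norm n f \<longleftrightarrow>
     (\<forall>x\<in>Rn n. 0 \<le> f x) \<and>
     (\<forall>x\<in>Rn n. f x = 0 \<longleftrightarrow> x = (\<lambda>_. 0)) \<and>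
     (\<forall>x\<in>Rn n. \<forall>c. f (\<lambda>i. c * x i) = \<bar>c\<bar> * f x) \<and>
     (\<forall>x\<in>Rn n. \<forall>y\<in>Rn n. f (\<lambda>i. x i + y i) \<le> f x + f y) \<and>
     (\<forall>x\<in>Rn n. \<forall>p. p permutes {..<n} \<longrightarrow> f (x \<circ> p) = f x) \<and>
     (\<forall>x\<in>Rn n. \<forall>d. (\<forall>i. d i = 1 \<or> d i = -1) \<longrightarrow> f (\<lambda>i. d i * x i) = f x)"

definition snorm :: "nat \<Rightarrow> ((nat \<Rightarrow> real) \<Rightarrow> real) \<Rightarrow> ('a::complex_inner \<Rightarrow> 'a) \<Rightarrow> real" where
  "snorm n f A = f (\<lambda>i. if i < n then sval (Suc i) A else 0)"

end

theory Submission
  imports Defs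
begin

text \<open>
  Write \<open>\<mu> = f(1,0,\<dots>,0)\<close>. A rank one operator has norm \<open>\<mu> s\<^sub>1\<close>, so submultiplicativity applied
  to a rank one projection gives \<open>\<mu> \<ge> 1\<close>, while monotonicity of \<open>f\<close> gives \<open>\<parallel>A\<parallel> \<ge> \<mu> s\<^sub>1(A)\<close> for all
  \<open>A\<close>. As \<open>s\<^sub>k(AB) \<le> s\<^sub>1(A) s\<^sub>k(B)\<close> and \<open>s\<^sub>k(AB) \<le> s\<^sub>k(A) s\<^sub>1(B)\<close>, the equality \<open>\<parallel>AB\<parallel> = \<parallel>A\<parallel> \<parallel>B\<parallel>\<close>
  forces \<open>\<parallel>A\<parallel> \<le> s\<^sub>1(A)\<close> and \<open>\<parallel>B\<parallel> \<le> s\<^sub>1(B)\<close>, hence \<open>\<mu> = 1\<close> and equality in both. Moreover \<open>f\<close> is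
  strictly increasing in the largest coordinate, so \<open>s\<^sub>1(AB) < s\<^sub>1(A) s\<^sub>1(B)\<close> would imply
  \<open>\<parallel>AB\<parallel> < \<parallel>A\<parallel> s\<^sub>1(B)\<close>. If only rank one operators satisfy \<open>\<parallel>T\<parallel> = s\<^sub>1(T)\<close>, the Riesz representation
  theorem writes \<open>A = xy\<^sup>*\<close> and \<open>B = wz\<^sup>*\<close>, and \<open>s\<^sub>1(AB) = s\<^sub>1(A) s\<^sub>1(B)\<close> is the equality case of the
  Cauchy--Schwarz inequality for \<open>w\<close> and \<open>y\<close>.
\<close>

section \<open>Symmetric norms\<close>

lemma symmetric_norm_nonneg: "symmetric_norm n f \<Longrightarrow> x \<in> Rn n \<Longrightarrow> 0 \<le> f x"
  unfolding symmetric_norm_def by blast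

lemma symmetric_norm_eq_0_iff:
  "symmetric_norm n f \<Longrightarrow> x \<in> Rn n \<Longrightarrow> f x = 0 \<longleftrightarrow> x = (\<lambda>_. 0)"
  unfolding symmetric_norm_def by blast

lemma symmetric_norm_scale:
  "symmetric_norm n f \<Longrightarrow> x \<in> Rn n \<Longrightarrow> f (\<lambda>i. c * x i) = \<bar>c\<bar> * f x"
  unfolding symmetric_norm_def by blast

lemma symmetric_norm_triangle:
  "symmetric_norm n f \<Longrightarrow> x \<in> Rn n \<Longrightarrow> y \<in> Rn n \<Longrightarrow> f (\<lambda>i. x i + y i) \<le> f x + f y"
  unfolding symmetric_norm_def by blast

lemma symmetric_norm_permute:
  "symmetric_norm n f \<Longrightarrow> x \<in> Rn n \<Longrightarrow> p permutes {..<n} \<Longrightarrow> f (x \<circ> p) = f x"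
  unfolding symmetric_norm_def by blast

lemma symmetric_norm_sign:
  "symmetric_norm n f \<Longrightarrow> x \<in> Rn n \<Longrightarrow> (\<And>i. d i = 1 \<or> d i = -1) \<Longrightarrow> f (\<lambda>i. d i * x i) = f x"
  unfolding symmetric_norm_def by blast

lemma Rn_scale: "x \<in> Rn n \<Longrightarrow> (\<lambda>i. c * x i) \<in> Rn n"
  by (simp add: Rn_def)

lemma Rn_permute:
  assumes "x \<in> Rn n" "p permutes {..<n}"
  shows "x \<circ> p \<in> Rn n"
proof -
  have "p i = i" if "i \<ge> n" for i
    using assms(2) that by (simp add: permutes_def)
  then show ?thesis using assms(1) by (simp add: Rn_def)
qed

lemma symmetric_norm_sum:
  assumes "symmetric_norm n f" "finite K" "\<And>k. k \<in> K \<Longrightarrow> y k \<in> Rn n"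
  shows "f (\<lambda>i. \<Sum>k\<in>K. y k i) \<le> (\<Sum>k\<in>K. f (y k))"
  using assms(2,3)
proof (induction K rule: finite_induct)
  case empty
  have "(\<lambda>_. 0) \<in> Rn n" by (simp add: Rn_def)
  then have "f (\<lambda>_. 0) = 0" using symmetric_norm_eq_0_iff[OF assms(1)] by blast
  then show ?case by simp
next
  case (insert a K)
  have "(\<lambda>i. \<Sum>k\<in>K. y k i) \<in> Rn n"
    using insert.prems by (auto simp: Rn_def intro!: sum.neutral)
  then have "f (\<lambda>i. y a i + (\<Sum>k\<in>K. y k i)) \<le> f (y a) + f (\<lambda>i. \<Sum>k\<in>K. y k i)"
    using symmetric_norm_triangle[OF assms(1)] insert.prems by simp
  then show ?case using insert by fastforce
qed

text \<open>The shrunken vector is a convex combination of \<open>y\<close> and its reflection in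
  coordinate \<open>i\<close>, which have the same norm. The weights are
  \<open>(1 + \<theta>) / 2\<close> and \<open>(1 - \<theta>) / 2\<close> with
  \<open>\<theta> = c / y i\<close>.\<close>

lemma symmetric_norm_shrink_coordinate:
  assumes "symmetric_norm n f" "y \<in> Rn n" "\<bar>c\<bar> \<le> \<bar>y i\<bar>"
  shows "f (y(i := c)) \<le> f y"
proof (cases "y i = 0")
  case True
  then have "y(i := c) = y" using assms(3) by auto
  then show ?thesis by simp
next
  case False
  define \<theta> where "\<theta> = c / y i"
  define d :: "nat \<Rightarrow> real" where "d = (\<lambda>j. if j = i then -1 else 1)"
  have \<theta>: "\<bar>\<theta>\<bar> \<le> 1" and c: "c = \<theta> * y i"
    using False assms(3) by (simp_all add: \<theta>_def abs_divide)
  have R: "(\<lambda>j. d j * y j) \<in> Rn n" using assms(2) by (simp add: Rn_def)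
  have "y(i := c) = (\<lambda>j. ((1 + \<theta>) / 2) * y j + ((1 - \<theta>) / 2) * (d j * y j))"
    by (auto simp: d_def c field_simps)
  then have "f (y(i := c)) \<le> f (\<lambda>j. ((1 + \<theta>) / 2) * y j) + f (\<lambda>j. ((1 - \<theta>) / 2) * (d j * y j))"
    by (simp only: symmetric_norm_triangle[OF assms(1) Rn_scale[OF assms(2)] Rn_scale[OF R]])
  also have "\<dots> = \<bar>(1 + \<theta>) / 2\<bar> * f y + \<bar>(1 - \<theta>) / 2\<bar> * f y"
    using symmetric_norm_sign[OF assms(1,2), of d]
    by (simp only: symmetric_norm_scale[OF assms(1) assms(2)] symmetric_norm_scale[OF assms(1) R])
      (simp add: d_def)
  also have "\<dots> = f y" using \<theta> by (simp add: abs_if field_simps split: if_splits)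
  finally show ?thesis .
qed

text \<open>Coordinates of \<open>y\<close> are replaced by those of \<open>x\<close> one at a time;
  each replacement shrinks a single coordinate.\<close>

lemma symmetric_norm_mono:
  assumes "symmetric_norm n f" "x \<in> Rn n" "y \<in> Rn n" "\<And>i. \<bar>x i\<bar> \<le> \<bar>y i\<bar>"
  shows "f x \<le> f y"
proof -
  have "f (\<lambda>i. if i < k then x i else y i) \<le> f y" for k
  proof (induction k)
    case 0
    then show ?case by simp
  next
    case (Suc k)
    let ?z = "\<lambda>i. if i < k then x i else y i"
    have "?z \<in> Rn n" using assms by (simp add: Rn_def)
    then have "f (?z(k := x k)) \<le> f ?z"
      using assms(4) by (intro symmetric_norm_shrink_coordinate[OF assms(1)]) auto
    moreover have "?z(k := x k) = (\<lambda>i. if i < Suc k then x i else y i)"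
      by (auto simp: less_Suc_eq)
    ultimately show ?case using Suc by simp
  qed
  moreover have "(\<lambda>i. if i < n then x i else y i) = x"
    using assms(2,3) by (auto simp: Rn_def)
  ultimately show ?thesis by metis
qed

text \<open>The maximum norm shows that only an increase of the largest coordinate can be guaranteed
  to count. The idea is to spread that increase over all coordinates, so that the result dominates a
  multiple of \<open>t\<close> with factor greater than 1.\<close>

lemma symmetric_norm_strict_mono_largest:
  assumes sym: "symmetric_norm n f" and n: "0 < n" and R: "t \<in> Rn n" "a \<in> Rn n"
    and t: "\<And>i. 0 \<le> t i" "\<And>i. t i \<le> t 0" "\<And>i. t i \<le> a i" "t 0 < a 0"
  shows "f t < f a"
proof -
  define u where "u = t(0 := a 0)"
  define \<delta> where "\<delta> = a 0 - t 0"
  \<comment> \<open>This weight makes \<open>(1 - l) * a 0 = t 0 + \<delta> / 2\<close>: coordinate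
    \<open>0\<close> gives up half of its surplus. The number \<open>c\<close> is then a gain
    available in every coordinate.\<close>
  define l where "l = \<delta> / (2 * a 0)"
  define c where "c = min (\<delta> / 2) (l * \<delta> / n)"
  define p where "p k = Transposition.transpose 0 k" for k :: nat
  \<comment> \<open>Mixing \<open>u\<close> with its average over the transpositions \<open>(0 k)\<close> moves a bit of the surplus \<open>\<delta>\<close>
    in coordinate \<open>0\<close> to every other coordinate without increasing the norm.\<close>
  define w where "w = (\<lambda>i. (1 - l) * u i + (l / n) * (\<Sum>k<n. (u \<circ> p k) i))"
  have a0: "a 0 > 0" using t(1)[of 0] t(4) by linarith
  have \<delta>: "0 < \<delta>" "\<delta> \<le> a 0" using t(1)[of 0] t(4) by (simp_all add: \<delta>_def)
  have l: "0 < l" "l \<le> 1/2" using a0 \<delta> by (simp_all add: l_def field_simps)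
  have c: "0 < c" "c \<le> \<delta> / 2" "c \<le> l * \<delta> / n"
    using \<delta> l n unfolding c_def by (simp, linarith, linarith)
  have uR: "u \<in> Rn n" using R n by (auto simp: u_def Rn_def)
  have u0: "u i \<ge> 0" for i using t(1) a0 by (simp add: u_def)
  have p: "p k permutes {..<n}" if "k < n" for k
    unfolding p_def using that n by (intro permutes_swap_id) auto
  have upR: "u \<circ> p k \<in> Rn n" if "k < n" for k
    using Rn_permute[OF uR p[OF that]] .
  have sR: "(\<lambda>i. \<Sum>k<n. (u \<circ> p k) i) \<in> Rn n"
    using upR by (auto simp: Rn_def intro!: sum.neutral)
  have wR: "w \<in> Rn n" using uR sR unfolding w_def Rn_def by simp
  have "f (\<lambda>i. \<Sum>k<n. (u \<circ> p k) i) \<le> (\<Sum>k<n. f (u \<circ> p k))"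
    by (rule symmetric_norm_sum[OF sym]) (use upR in \<open>auto simp: o_def\<close>)
  also have "\<dots> = n * f u"
    using symmetric_norm_permute[OF sym uR p] by simp
  finally have avg: "f (\<lambda>i. \<Sum>k<n. (u \<circ> p k) i) \<le> n * f u" .
  have "f w \<le> \<bar>1 - l\<bar> * f u + \<bar>l / n\<bar> * f (\<lambda>i. \<Sum>k<n. (u \<circ> p k) i)"
    using symmetric_norm_triangle[OF sym Rn_scale[OF uR, of "1 - l"] Rn_scale[OF sR, of "l / n"]]
    by (simp only: w_def symmetric_norm_scale[OF sym uR] symmetric_norm_scale[OF sym sR])
  also have "\<dots> \<le> \<bar>1 - l\<bar> * f u + \<bar>l / n\<bar> * (n * f u)"
    using avg by (intro add_left_mono mult_left_mono) auto
  also have "\<dots> = f u" using l n by (simp add: algebra_simps)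
  finally have wu: "f w \<le> f u" .
  have ge: "w i \<ge> t i + c" if "i < n" for i
  proof (cases "i = 0")
    case True
    have "0 \<le> (l / n) * (\<Sum>k<n. (u \<circ> p k) i)"
      using l u0 by (intro mult_nonneg_nonneg sum_nonneg) auto
    moreover have "(1 - l) * u i = t 0 + \<delta> / 2"
      using True a0 by (simp add: u_def l_def \<delta>_def field_simps)
    moreover have "t i = t 0" using True by simp
    ultimately show ?thesis using c(2) unfolding w_def by linarith
  next
    case False
    \<comment> \<open>For \<open>i \<noteq> 0\<close> only the transposition of \<open>0\<close> and
      \<open>i\<close> brings the large entry \<open>a 0\<close> into coordinate
      \<open>i\<close>.\<close>
    have "(u \<circ> p k) i = (if k = i then a 0 else t i)" for k
      using False by (auto simp: u_def p_def Transposition.transpose_def)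
    then have "(\<Sum>k<n. (u \<circ> p k) i) = (\<Sum>k<n. (if k = i then a 0 - t i else 0) + t i)"
      by (intro sum.cong) auto
    also have "\<dots> = (a 0 - t i) + n * t i"
      using that by (simp add: sum.distrib)
    finally have "w i = (1 - l) * u i + (l / n) * ((a 0 - t i) + n * t i)"
      by (simp only: w_def)
    then have "w i = t i + (l / n) * (a 0 - t i)"
      using False n by (simp add: u_def field_simps)
    moreover have "(l / n) * (a 0 - t i) \<ge> (l / n) * \<delta>"
      using l t(2)[of i] by (intro mult_left_mono) (auto simp: \<delta>_def)
    ultimately show ?thesis using c(3) by simp
  qed
  \<comment> \<open>The additive gain \<open>c\<close> becomes a multiplicative one: as
    \<open>t i \<le> a 0\<close>, the factor \<open>1 + c / a 0\<close> raises \<open>t i\<close> by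
    at most \<open>c\<close>.\<close>
  have "f (\<lambda>i. (1 + c / a 0) * t i) \<le> f w"
  proof (rule symmetric_norm_mono[OF sym Rn_scale[OF R(1)] wR])
    fix i
    show "\<bar>(1 + c / a 0) * t i\<bar> \<le> \<bar>w i\<bar>"
    proof (cases "i < n")
      case True
      have "t i \<le> a 0" using t(2)[of i] t(4) by linarith
      then have "c * t i / a 0 \<le> c" using a0 c(1) by (simp add: field_simps)
      moreover have "(1 + c / a 0) * t i = t i + c * t i / a 0" by (simp add: algebra_simps)
      moreover have "0 \<le> (1 + c / a 0) * t i" using a0 c(1) t(1) by simp
      ultimately show ?thesis using ge[OF True] by linarith
    next
      case False
      then show ?thesis using R by (simp add: Rn_def)
    qed
  qed
  then have less: "(1 + c / a 0) * f t \<le> f w"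
    using a0 c(1) by (simp add: symmetric_norm_scale[OF sym R(1)])
  have ua: "f u \<le> f a"
  proof (rule symmetric_norm_mono[OF sym uR R(2)])
    fix i
    show "\<bar>u i\<bar> \<le> \<bar>a i\<bar>" using t(1)[of i] t(3)[of i] a0 by (simp add: u_def)
  qed
  show ?thesis
  proof (cases "f t = 0")
    case True
    have "a \<noteq> (\<lambda>_. 0)" using a0 by (metis less_irrefl)
    then show ?thesis
      using True symmetric_norm_eq_0_iff[OF sym R(2)] symmetric_norm_nonneg[OF sym R(2)] by linarith
  next
    case False
    then have "f t > 0" using symmetric_norm_nonneg[OF sym R(1)] by linarith
    then have "f t < (1 + c / a 0) * f t" using a0 c(1) by simp
    then show ?thesis using less wu ua by linarith
  qed
qed

section \<open>Complex inner product spaces\<close>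

lemma scaleC_zero_left [simp]: "0 *\<^sub>C (x::'a::complex_inner) = 0"
  using scaleC_add_left[of 0 0 x] by simp

lemma scaleC_zero_right [simp]: "c *\<^sub>C (0::'a::complex_inner) = 0"
  using scaleC_add_right[of c 0 "0::'a"] by simp

lemma scaleC_sum_left: "(\<Sum>s\<in>S. g s) *\<^sub>C (x::'a::complex_inner) = (\<Sum>s\<in>S. g s *\<^sub>C x)"
  by (induction S rule: infinite_finite_induct) (auto simp: scaleC_add_left)

lemma cinner_diff_left: "cinner ((x::'a::complex_inner) - y) z = cinner x z - cinner y z"
  using cinner_add_left[of "x - y" y z] by simp

lemma cinner_zero_left [simp]: "cinner (0::'a::complex_inner) z = 0"
  using cinner_diff_left[of 0 0 z] by simp

lemma cinner_add_right: "cinner (z::'a::complex_inner) (x + y) = cinner z x + cinner z y"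
  by (metis cinner_add_left cinner_commute complex_cnj_add)

lemma cinner_scaleC_right: "cinner (z::'a::complex_inner) (c *\<^sub>C x) = cnj c * cinner z x"
  by (metis cinner_scaleC_left cinner_commute complex_cnj_mult)

lemma cinner_diff_right: "cinner (z::'a::complex_inner) (x - y) = cinner z x - cinner z y"
  using cinner_add_right[of z "x - y" y] by simp

lemma cinner_self: "cinner (x::'a::complex_inner) x = complex_of_real ((norm x)\<^sup>2)"
proof (rule complex_eqI)
  show "Re (cinner x x) = Re (complex_of_real ((norm x)\<^sup>2))"
    by (simp add: Re_cinner power2_norm_eq_inner)
  show "Im (cinner x x) = Im (complex_of_real ((norm x)\<^sup>2))"
    using arg_cong[OF cinner_commute[of x x], of Im] by simp
qed

lemma norm_scaleC: "norm (c *\<^sub>C (x::'a::complex_inner)) = cmod c * norm x"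
proof -
  have "complex_of_real ((norm (c *\<^sub>C x))\<^sup>2) = (c * cnj c) * complex_of_real ((norm x)\<^sup>2)"
    by (simp only: cinner_self[symmetric] cinner_scaleC_left cinner_scaleC_right mult_ac)
  also have "\<dots> = complex_of_real ((cmod c * norm x)\<^sup>2)"
    by (simp add: complex_norm_square[symmetric] power_mult_distrib)
  finally have "(norm (c *\<^sub>C x))\<^sup>2 = (cmod c * norm x)\<^sup>2"
    using of_real_eq_iff by blast
  then show ?thesis by (simp add: power2_eq_iff_nonneg)
qed

lemma norm_normalize:
  "(x::'a::complex_inner) \<noteq> 0 \<Longrightarrow> norm (complex_of_real (inverse (norm x)) *\<^sub>C x) = 1"
  by (simp add: norm_scaleC norm_inverse)

lemma scaleC_eq_0_iff: "c *\<^sub>C (x::'a::complex_inner) = 0 \<longleftrightarrow> c = 0 \<or> x = 0"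
  using norm_scaleC[of c x] by (metis mult_eq_0_iff norm_eq_zero)

text \<open>Pythagoras for the projection onto the line of \<open>y\<close>. This identity yields
  the Cauchy-Schwarz inequality, its equality case (zero residual), and the orthogonality in the
  Riesz theorem.\<close>

lemma norm_diff_projection:
  fixes w y :: "'a::complex_inner"
  assumes "norm y = 1"
  shows "(norm (w - cinner w y *\<^sub>C y))\<^sup>2 = (norm w)\<^sup>2 - (cmod (cinner w y))\<^sup>2"
proof -
  let ?c = "cinner w y"
  have "complex_of_real ((norm (w - ?c *\<^sub>C y))\<^sup>2)
      = cinner w w - cnj ?c * ?c - ?c * cinner y w + ?c * cnj ?c * cinner y y"
    by (simp only: cinner_self[symmetric] cinner_diff_left cinner_diff_right cinner_scaleC_left
        cinner_scaleC_right) (simp add: algebra_simps)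
  also have "\<dots> = cinner w w - ?c * cnj ?c"
    using assms by (simp add: cinner_self[of y] cinner_commute[of y w])
  also have "\<dots> = complex_of_real ((norm w)\<^sup>2 - (cmod ?c)\<^sup>2)"
    by (simp add: cinner_self complex_norm_square[symmetric])
  finally show ?thesis using of_real_eq_iff by blast
qed

lemma cinner_Cauchy_Schwarz: "cmod (cinner (w::'a::complex_inner) y) \<le> norm w * norm y"
proof (cases "y = 0")
  case True
  then show ?thesis using cinner_commute[of w 0] by simp
next
  case False
  define e where "e = complex_of_real (inverse (norm y)) *\<^sub>C y"
  have e: "norm e = 1" using False by (simp add: e_def norm_normalize del: of_real_inverse)
  have "0 \<le> (norm w)\<^sup>2 - (cmod (cinner w e))\<^sup>2"
    using norm_diff_projection[OF e, of w] zero_le_power2 by metis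
  then have "cmod (cinner w e) \<le> norm w" by (simp add: power2_le_iff_abs_le)
  then show ?thesis
    using False by (simp add: e_def cinner_scaleC_right norm_mult norm_divide field_simps)
qed

lemma cinner_Cauchy_Schwarz_eq:
  fixes w y :: "'a::complex_inner"
  assumes "norm y = 1" "cmod (cinner w y) = norm w"
  shows "w = cinner w y *\<^sub>C y"
  using norm_diff_projection[OF assms(1), of w] assms(2) by simp

text \<open>The point \<open>q\<close> of least norm in the affine hyperplane where
  \<open>\<phi>\<close> equals 1 is orthogonal to the kernel of \<open>\<phi>\<close>, and
  \<open>v - \<phi> v *\<^sub>C q\<close> always lies in the kernel.\<close>

theorem Riesz_representation:
  fixes \<phi> :: "'a::chilbert \<Rightarrow> complex"
  assumes add: "\<And>u v. \<phi> (u + v) = \<phi> u + \<phi> v" and scale: "\<And>c u. \<phi> (c *\<^sub>C u) = c * \<phi> u"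
    and bound: "\<And>u. cmod (\<phi> u) \<le> norm u * K"
  obtains y where "\<And>v. \<phi> v = cinner v y"
proof (cases "\<forall>v. \<phi> v = 0")
  case True
  then show ?thesis using that[of 0] cinner_commute[of _ "0::'a"] by simp
next
  case False
  then obtain v0 where v0: "\<phi> v0 \<noteq> 0" by blast
  define F where "F = {u. \<phi> u = 1}"
  define d where "d = Inf (norm ` F)"
  have F0: "inverse (\<phi> v0) *\<^sub>C v0 \<in> F" using v0 by (simp add: F_def scale)
  have bdd: "bdd_below (norm ` F)" by (rule bdd_belowI[of _ 0]) auto
  have d_le: "d \<le> norm u" if "u \<in> F" for u
    unfolding d_def using that bdd by (intro cInf_lower) auto
  have d0: "0 \<le> d" unfolding d_def using F0 by (intro cInf_greatest) auto
  have diff: "\<phi> (u - v) = \<phi> u - \<phi> v" for u v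
    using add[of "u - v" v] by simp
  have "\<exists>u. u \<in> F \<and> norm u < d + 1 / real (Suc k)" for k
  proof -
    have "Inf (norm ` F) < d + 1 / real (Suc k)" by (simp add: d_def)
    then show ?thesis using F0 bdd by (subst (asm) cInf_less_iff) auto
  qed
  then obtain u where u: "\<And>k. u k \<in> F" "\<And>k. norm (u k) < d + 1 / real (Suc k)"
    by metis
  have lim: "(\<lambda>k. norm (u k)) \<longlonglongrightarrow> d"
  proof (rule tendsto_sandwich[of "\<lambda>_. d"])
    show "(\<lambda>k. d + 1 / real (Suc k)) \<longlonglongrightarrow> d"
      using LIMSEQ_inverse_real_of_nat_add[of d] by (simp add: inverse_eq_divide)
    show "\<forall>\<^sub>F k in sequentially. d \<le> norm (u k)" using d_le u(1) by simp
    show "\<forall>\<^sub>F k in sequentially. norm (u k) \<le> d + 1 / real (Suc k)"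
      using u(2) by (intro always_eventually allI less_imp_le)
  qed simp
  \<comment> \<open>A minimizing sequence in the affine hyperplane \<open>F\<close> is Cauchy by the parallelogram law.\<close>
  have para: "(norm (u j - u k))\<^sup>2 \<le> 2 * ((norm (u j))\<^sup>2 - d\<^sup>2) + 2 * ((norm (u k))\<^sup>2 - d\<^sup>2)" for j k
  proof -
    \<comment> \<open>The midpoint stays in \<open>F\<close>, which bounds the norm of the sum below
      by \<open>2 * d\<close>.\<close>
    have "\<phi> ((1/2::complex) *\<^sub>C (u j + u k)) = 1"
      using u(1) by (simp only: scale add) (simp add: F_def)
    then have "d \<le> norm ((1/2::complex) *\<^sub>C (u j + u k))" using d_le by (simp add: F_def)
    then have "2 * d \<le> norm (u j + u k)" by (simp add: norm_scaleC norm_divide)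
    then have "(2 * d)\<^sup>2 \<le> (norm (u j + u k))\<^sup>2" using d0 by (intro power_mono) auto
    moreover have "(norm (u j - u k))\<^sup>2 + (norm (u j + u k))\<^sup>2 = 2 * (norm (u j))\<^sup>2 + 2 * (norm (u k))\<^sup>2"
      by (simp add: power2_norm_eq_inner inner_diff_left inner_diff_right inner_add_left
          inner_add_right inner_commute)
    ultimately show ?thesis by (simp add: power_mult_distrib)
  qed
  have "Cauchy u"
  proof (rule metric_CauchyI)
    fix e :: real assume e: "0 < e"
    have "(\<lambda>k. (norm (u k))\<^sup>2) \<longlonglongrightarrow> d\<^sup>2" using lim by (intro tendsto_intros)
    then have "\<forall>\<^sub>F k in sequentially. (norm (u k))\<^sup>2 < d\<^sup>2 + e\<^sup>2 / 4"
      using e by (intro order_tendstoD(2)) auto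
    then obtain M where M: "\<And>k. k \<ge> M \<Longrightarrow> (norm (u k))\<^sup>2 < d\<^sup>2 + e\<^sup>2 / 4"
      by (auto simp: eventually_sequentially)
    have "dist (u j) (u k) < e" if "j \<ge> M" "k \<ge> M" for j k
    proof -
      have "(norm (u j - u k))\<^sup>2 < e\<^sup>2"
        using para[of j k] M[OF that(1)] M[OF that(2)] by argo
      then show ?thesis using e by (simp add: dist_norm power2_less_imp_less)
    qed
    then show "\<exists>M. \<forall>m\<ge>M. \<forall>n\<ge>M. dist (u m) (u n) < e" by blast
  qed
  then obtain q where q: "u \<longlonglongrightarrow> q" using Cauchy_convergent_iff convergent_def by blast
  have nq: "norm q = d" using tendsto_norm[OF q] lim by (rule LIMSEQ_unique)
  have \<phi>q: "\<phi> q = 1"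
  proof -
    \<comment> \<open>Boundedness sends \<open>\<phi> (u k - q)\<close> to 0, yet this sequence is
      constantly \<open>1 - \<phi> q\<close>.\<close>
    have "(\<lambda>k. norm (u k - q) * K) \<longlonglongrightarrow> 0 * K"
      using q by (intro tendsto_intros) (simp add: LIM_zero tendsto_norm_zero)
    then have "(\<lambda>k. norm (u k - q) * K) \<longlonglongrightarrow> 0" by simp
    then have "(\<lambda>k. \<phi> (u k - q)) \<longlonglongrightarrow> 0"
      by (rule Lim_null_comparison[OF always_eventually[OF allI[OF bound]]])
    then have "(\<lambda>k::nat. 1 - \<phi> q) \<longlonglongrightarrow> 0" using u(1) by (simp add: diff F_def)
    then show ?thesis by (simp add: LIMSEQ_const_iff)
  qed
  have q0: "q \<noteq> 0" using \<phi>q scale[of 0 q] by auto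
  have orth: "cinner h q = 0" if h: "\<phi> h = 0" for h
  proof (cases "h = 0")
    case False
    define e where "e = complex_of_real (inverse (norm h)) *\<^sub>C h"
    have e: "norm e = 1" using False by (simp add: e_def norm_normalize del: of_real_inverse)
    \<comment> \<open>Removing the component along a kernel vector stays in \<open>F\<close>, so
      minimality of the norm of \<open>q\<close> forces that component to vanish.\<close>
    have "q - cinner q e *\<^sub>C e \<in> F" using h \<phi>q by (simp add: F_def diff scale e_def)
    then have "d\<^sup>2 \<le> (norm (q - cinner q e *\<^sub>C e))\<^sup>2" using d_le d0 by (intro power_mono) auto
    then have "cinner q e = 0" using norm_diff_projection[OF e, of q] nq by simp
    then have "cinner q h = 0" using False by (simp add: e_def cinner_scaleC_right)
    then show ?thesis using cinner_commute[of h q] by simp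
  qed simp
  show ?thesis
  proof (rule that)
    fix v
    have "\<phi> (v - \<phi> v *\<^sub>C q) = 0" by (simp add: diff scale \<phi>q)
    then have "cinner v q = \<phi> v * cinner q q"
      using orth[of "v - \<phi> v *\<^sub>C q"] by (simp add: cinner_diff_left cinner_scaleC_left)
    then show "\<phi> v = cinner v (complex_of_real (inverse ((norm q)\<^sup>2)) *\<^sub>C q)"
      using q0 by (simp add: cinner_self cinner_scaleC_right)
  qed
qed

section \<open>Bounded operators, rank and singular values\<close>

lemma bop_add: "bop A \<Longrightarrow> A (x + y) = A x + A y"
  unfolding bop_def by blast

lemma bop_scaleC: "bop A \<Longrightarrow> A (c *\<^sub>C x) = c *\<^sub>C A x"
  unfolding bop_def by blast

lemma bop_bounded_linear:
  assumes "bop A"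
  shows "bounded_linear A"
proof -
  obtain K where "\<And>x. norm (A x) \<le> norm x * K" using assms unfolding bop_def by blast
  then show ?thesis
    by (intro bounded_linear_intro[of A K])
      (use assms in \<open>auto simp: bop_add bop_scaleC scaleR_scaleC\<close>)
qed

lemma bop_zero [simp]: "bop (\<lambda>_. 0)"
  unfolding bop_def by (auto intro: exI[of _ 0])

lemma bop_comp:
  assumes "bop A" "bop B"
  shows "bop (A \<circ> B)"
proof -
  have "bounded_linear (\<lambda>x. A (B x))"
    using assms bop_bounded_linear bounded_linear_compose by blast
  then have "\<exists>K. \<forall>x. norm (A (B x)) \<le> norm x * K" using bounded_linear.bounded by blast
  then show ?thesis using assms by (simp add: bop_def)
qed

lemma bounded_linear_bop_diff: "bop A \<Longrightarrow> bop X \<Longrightarrow> bounded_linear (\<lambda>v. A v - X v)"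
  by (intro bounded_linear_sub bop_bounded_linear)

lemma bop_sum: "bop A \<Longrightarrow> A (\<Sum>s\<in>S. c s *\<^sub>C s) = (\<Sum>s\<in>S. c s *\<^sub>C A s)"
  by (simp add: linear_sum[OF bounded_linear.linear[OF bop_bounded_linear]] bop_scaleC)

lemma bop_eq_0_iff_onorm: "bop A \<Longrightarrow> onorm A = 0 \<longleftrightarrow> A = (\<lambda>_. 0)"
  using onorm_eq_0[OF bop_bounded_linear] by auto

lemma onorm_bop_pos:
  assumes "bop A" "A \<noteq> (\<lambda>_. 0)"
  shows "0 < onorm A"
  using assms bop_eq_0_iff_onorm[of A] onorm_pos_le[OF bop_bounded_linear, of A] by linarith

section \<open>Rank and its behaviour under composition\<close>

lemma crank_less_iff:
  "crank X < enat k \<longleftrightarrow> (\<exists>S. finite S \<and> range X \<subseteq> cspan S \<and> card S < k)"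
  unfolding crank_def by (auto simp: INF_less_iff)

lemma crank_less_1_iff: "crank X < enat (Suc 0) \<longleftrightarrow> X = (\<lambda>_. 0)"
proof
  assume "crank X < enat (Suc 0)"
  then show "X = (\<lambda>_. 0)" by (force simp: crank_less_iff cspan_def)
next
  assume "X = (\<lambda>_. 0)"
  then show "crank X < enat (Suc 0)"
    unfolding crank_less_iff by (intro exI[of _ "{}"]) (auto simp: cspan_def)
qed

text \<open>Rank one means below two but not below one; a nonzero operator excludes the empty
  spanning set, which leaves a single direction \<open>x\<close>.\<close>

lemma crank_eq_1_iff:
  "crank X = 1 \<longleftrightarrow> X \<noteq> (\<lambda>_. 0) \<and> (\<exists>x. \<forall>v. \<exists>c. X v = c *\<^sub>C x)"
proof -
  have "crank X = 1 \<longleftrightarrow> \<not> crank X < enat (Suc 0) \<and> crank X < enat (Suc (Suc 0))"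
    by (cases "crank X") (auto simp: one_enat_def)
  also have "\<dots> \<longleftrightarrow> X \<noteq> (\<lambda>_. 0) \<and> (\<exists>x. \<forall>v. \<exists>c. X v = c *\<^sub>C x)"
  proof (rule conj_cong, goal_cases)
    case 1
    show "\<not> crank X < enat (Suc 0) \<longleftrightarrow> X \<noteq> (\<lambda>_. 0)" by (simp add: crank_less_1_iff)
  next
    case X: 2
    show ?case
    proof
      assume "crank X < enat (Suc (Suc 0))"
      then obtain S where S: "finite S" "range X \<subseteq> cspan S" "card S < Suc (Suc 0)"
        by (auto simp: crank_less_iff)
      have "card S \<noteq> 0"
      proof
        assume "card S = 0"
        then have "crank X < enat (Suc 0)"
          unfolding crank_less_iff using S by (intro exI[of _ S]) simp
        then show False using X crank_less_1_iff by blast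
      qed
      then have "card S = 1" using S(3) by linarith
      then obtain x where "S = {x}" by (auto simp: card_1_singleton_iff)
      then show "\<exists>x. \<forall>v. \<exists>c. X v = c *\<^sub>C x" using S(2) by (fastforce simp: cspan_def)
    next
      assume "\<exists>x. \<forall>v. \<exists>c. X v = c *\<^sub>C x"
      then obtain x where x: "\<And>v. \<exists>c. X v = c *\<^sub>C x" by blast
      have "range X \<subseteq> cspan {x}"
      proof clarsimp
        fix v
        obtain c where "X v = c *\<^sub>C x" using x by blast
        then show "X v \<in> cspan {x}" unfolding cspan_def by (auto intro: exI[of _ "\<lambda>_. c"])
      qed
      then show "crank X < enat (Suc (Suc 0))"
        unfolding crank_less_iff by (intro exI[of _ "{x}"]) auto
    qed
  qed
  finally show ?thesis .
qed

lemma crank_comp_right: "crank X < enat k \<Longrightarrow> crank (X \<circ> B) < enat k"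
  unfolding crank_less_iff by (auto simp: image_subset_iff)

lemma crank_comp_left:
  assumes "bop A" "crank X < enat k"
  shows "crank (A \<circ> X) < enat k"
proof -
  obtain S where S: "finite S" "range X \<subseteq> cspan S" "card S < k"
    using assms(2) crank_less_iff by blast
  have "A y \<in> cspan (A ` S)" if y: "y \<in> cspan S" for y
  proof -
    obtain c where "y = (\<Sum>s\<in>S. c s *\<^sub>C s)" using y by (auto simp: cspan_def)
    then have "A y = (\<Sum>s\<in>S. c s *\<^sub>C A s)" by (simp add: bop_sum[OF assms(1)])
    \<comment> \<open>\<open>A\<close> may identify elements of \<open>S\<close>, so the sum is
      grouped by fibres before coefficients are read off.\<close>
    also have "\<dots> = (\<Sum>t\<in>A ` S. \<Sum>s\<in>{s\<in>S. A s = t}. c s *\<^sub>C A s)"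
      by (rule sum.image_gen[OF S(1)])
    also have "\<dots> = (\<Sum>t\<in>A ` S. (\<Sum>s\<in>{s\<in>S. A s = t}. c s) *\<^sub>C t)"
      by (intro sum.cong refl) (simp add: scaleC_sum_left)
    finally show ?thesis
      unfolding cspan_def by (auto intro: exI[of _ "\<lambda>t. \<Sum>s\<in>{s\<in>S. A s = t}. c s"])
  qed
  then have "range (A \<circ> X) \<subseteq> cspan (A ` S)" using S(2) by auto
  moreover have "card (A ` S) < k" using card_image_le[OF S(1), of A] S(3) by linarith
  ultimately show ?thesis unfolding crank_less_iff using S(1) by blast
qed

section \<open>Singular values as approximation numbers\<close>

lemma sval_le:
  assumes "bop A" "bop X" "crank X < enat k"
  shows "sval k A \<le> onorm (\<lambda>v. A v - X v)"
  unfolding sval_def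
proof (rule cInf_lower)
  show "bdd_below {onorm (\<lambda>v. A v - X v) |X. bop X \<and> crank X < enat k}"
    using assms(1) by (intro bdd_belowI[of _ 0]) (auto intro!: onorm_pos_le bounded_linear_bop_diff)
qed (use assms in blast)

text \<open>The index \<open>Suc k\<close> makes the zero operator an admissible competitor, so the
  infimum is over a nonempty set; no operator has rank below 0.\<close>

lemma sval_ge:
  assumes "\<And>X. bop X \<Longrightarrow> crank X < enat (Suc k) \<Longrightarrow> b \<le> onorm (\<lambda>v. A v - X v)"
  shows "b \<le> sval (Suc k) A"
  unfolding sval_def
proof (rule cInf_greatest)
  have "crank (\<lambda>_::'a. 0::'a) < enat (Suc k)"
    using crank_less_1_iff[of "\<lambda>_::'a. 0::'a"] order_less_le_trans[of _ "enat (Suc 0)" "enat (Suc k)"]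
    by simp
  then show "{onorm (\<lambda>v. A v - X v) |X. bop X \<and> crank X < enat (Suc k)} \<noteq> {}"
    using bop_zero by blast
qed (use assms in blast)

lemma sval_nonneg: "bop A \<Longrightarrow> 0 \<le> sval (Suc k) A"
  by (intro sval_ge onorm_pos_le bounded_linear_bop_diff)

lemma sval_1:
  assumes "bop A"
  shows "sval (Suc 0) A = onorm A"
proof (rule antisym)
  show "sval (Suc 0) A \<le> onorm A"
    using sval_le[OF assms bop_zero, of "Suc 0"] by (simp add: crank_less_1_iff)
  show "onorm A \<le> sval (Suc 0) A"
    by (rule sval_ge) (simp add: crank_less_1_iff)
qed

lemma sval_le_onorm:
  assumes "bop A"
  shows "sval (Suc k) A \<le> onorm A"
proof -
  have "crank (\<lambda>_::'a. 0::'a) < enat (Suc k)"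
    using crank_less_1_iff[of "\<lambda>_::'a. 0::'a"] order_less_le_trans[of _ "enat (Suc 0)" "enat (Suc k)"]
    by simp
  then show ?thesis using sval_le[OF assms bop_zero] by simp
qed

lemma sval_eq_0:
  assumes "bop A" "crank A < enat (Suc k)"
  shows "sval (Suc k) A = 0"
  using sval_le[OF assms(1,1,2)] sval_nonneg[OF assms(1), of k] by (simp add: onorm_zero)

text \<open>If \<open>X\<close> competes in the infimum for \<open>B\<close>, then
  \<open>A \<circ> X\<close> competes for \<open>A \<circ> B\<close>. Dividing by
  \<open>onorm A\<close> makes \<open>sval_ge\<close> applicable, hence the separate case of zero
  \<open>A\<close>.\<close>

lemma sval_comp_left:
  assumes "bop A" "bop B"
  shows "sval (Suc k) (A \<circ> B) \<le> onorm A * sval (Suc k) B"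
proof (cases "A = (\<lambda>_. 0)")
  case True
  then show ?thesis
    using sval_le_onorm[OF bop_zero, of k] sval_nonneg[OF bop_zero, of k]
    by (simp add: o_def onorm_zero)
next
  case False
  then have pos: "0 < onorm A" using onorm_bop_pos assms(1) by blast
  have "sval (Suc k) (A \<circ> B) / onorm A \<le> sval (Suc k) B"
  proof (rule sval_ge)
    fix X :: "'a \<Rightarrow> 'a" assume X: "bop X" "crank X < enat (Suc k)"
    have "sval (Suc k) (A \<circ> B) \<le> onorm (\<lambda>v. (A \<circ> B) v - (A \<circ> X) v)"
      using assms X by (intro sval_le bop_comp crank_comp_left)
    also have "(\<lambda>v. (A \<circ> B) v - (A \<circ> X) v) = A \<circ> (\<lambda>v. B v - X v)"
      using assms(1) by (auto simp: linear_diff[OF bounded_linear.linear[OF bop_bounded_linear]])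
    also have "onorm \<dots> \<le> onorm A * onorm (\<lambda>v. B v - X v)"
      using assms X by (intro onorm_compose bop_bounded_linear bounded_linear_bop_diff)
    finally show "sval (Suc k) (A \<circ> B) / onorm A \<le> onorm (\<lambda>v. B v - X v)"
      using pos by (simp add: field_simps o_def)
  qed
  then show ?thesis using pos by (simp add: field_simps)
qed

text \<open>The mirror argument: \<open>X \<circ> B\<close> competes for \<open>A \<circ> B\<close>
  because its range lies in that of \<open>X\<close>.\<close>

lemma sval_comp_right:
  assumes "bop A" "bop B"
  shows "sval (Suc k) (A \<circ> B) \<le> onorm B * sval (Suc k) A"
proof (cases "B = (\<lambda>_. 0)")
  case True
  have "A 0 = 0" using bop_scaleC[OF assms(1), of 0] by simp
  with True show ?thesis
    using sval_le_onorm[OF bop_zero, of k] sval_nonneg[OF bop_zero, of k]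
    by (simp add: o_def onorm_zero)
next
  case False
  then have pos: "0 < onorm B" using onorm_bop_pos assms(2) by blast
  have "sval (Suc k) (A \<circ> B) / onorm B \<le> sval (Suc k) A"
  proof (rule sval_ge)
    fix X :: "'a \<Rightarrow> 'a" assume X: "bop X" "crank X < enat (Suc k)"
    have "sval (Suc k) (A \<circ> B) \<le> onorm (\<lambda>v. (A \<circ> B) v - (X \<circ> B) v)"
      using assms X by (intro sval_le bop_comp crank_comp_right)
    also have "(\<lambda>v. (A \<circ> B) v - (X \<circ> B) v) = (\<lambda>v. A v - X v) \<circ> B"
      by auto
    also have "onorm \<dots> \<le> onorm (\<lambda>v. A v - X v) * onorm B"
      using assms X by (intro onorm_compose bop_bounded_linear bounded_linear_bop_diff)
    finally show "sval (Suc k) (A \<circ> B) / onorm B \<le> onorm (\<lambda>v. A v - X v)"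
      using pos by (simp add: field_simps o_def)
  qed
  then show ?thesis using pos by (simp add: field_simps)
qed

section \<open>Rank one operators\<close>

lemma bop_rank_one: "bop (\<lambda>v. cinner v y *\<^sub>C x)"
  unfolding bop_def
proof (intro conjI allI)
  have "norm (cinner v y *\<^sub>C x) \<le> norm v * (norm y * norm x)" for v
    using mult_right_mono[OF cinner_Cauchy_Schwarz[of v y] norm_ge_zero[of x]]
    by (simp add: norm_scaleC mult.assoc)
  then show "\<exists>K. \<forall>v. norm (cinner v y *\<^sub>C x) \<le> norm v * K" by blast
qed (simp_all add: cinner_add_left cinner_scaleC_left scaleC_add_left scaleC_scaleC)

lemma onorm_rank_one:
  fixes x y :: "'a::complex_inner"
  shows "onorm (\<lambda>v. cinner v y *\<^sub>C x) = norm x * norm y"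
proof (rule antisym)
  show "onorm (\<lambda>v. cinner v y *\<^sub>C x) \<le> norm x * norm y"
  proof (rule onorm_bound)
    fix v
    show "norm (cinner v y *\<^sub>C x) \<le> norm x * norm y * norm v"
      using mult_right_mono[OF cinner_Cauchy_Schwarz[of v y] norm_ge_zero[of x]]
      by (simp add: norm_scaleC mult_ac)
  qed simp
next
  show "norm x * norm y \<le> onorm (\<lambda>v. cinner v y *\<^sub>C x)"
  proof (cases "y = 0")
    case True
    then show ?thesis using onorm_pos_le[OF bop_bounded_linear[OF bop_rank_one]] by simp
  next
    case False
    \<comment> \<open>The norm is attained in the direction of \<open>y\<close>.\<close>
    have "norm (cinner y y *\<^sub>C x) \<le> onorm (\<lambda>v. cinner v y *\<^sub>C x) * norm y"
      by (rule onorm[OF bop_bounded_linear[OF bop_rank_one]])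
    then have "(norm x * norm y) * norm y \<le> onorm (\<lambda>v. cinner v y *\<^sub>C x) * norm y"
      by (simp add: norm_scaleC cinner_self norm_mult power2_eq_square mult_ac)
    then show ?thesis using False by simp
  qed
qed

lemma rank_one_eq_0_iff:
  fixes x y :: "'a::complex_inner"
  shows "(\<lambda>v. cinner v y *\<^sub>C x) = (\<lambda>_. 0) \<longleftrightarrow> x = 0 \<or> y = 0"
  using bop_eq_0_iff_onorm[OF bop_rank_one, of y x] onorm_rank_one[of y x] by auto

lemma crank_rank_one:
  assumes "x \<noteq> 0" "y \<noteq> 0"
  shows "crank (\<lambda>v. cinner v y *\<^sub>C x) = 1"
  unfolding crank_eq_1_iff using assms rank_one_eq_0_iff[of y x] by blast

text \<open>The coefficient of \<open>A v\<close> along the range direction \<open>x\<close> is a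
  bounded linear functional of \<open>v\<close>, and Riesz represents it by some
  \<open>y\<close>.\<close>

lemma crank_1_obtain:
  fixes A :: "'a::chilbert \<Rightarrow> 'a"
  assumes "bop A" "crank A = 1"
  obtains x y where "x \<noteq> 0" "y \<noteq> 0" "A = (\<lambda>v. cinner v y *\<^sub>C x)"
proof -
  obtain x where A0: "A \<noteq> (\<lambda>_. 0)" and x: "\<And>v. \<exists>c. A v = c *\<^sub>C x"
    using assms(2) crank_eq_1_iff by blast
  have x0: "x \<noteq> 0"
  proof
    assume "x = 0"
    then have "A v = 0" for v using x[of v] by auto
    then show False using A0 by blast
  qed
  define \<phi> where "\<phi> v = cinner (A v) x / cinner x x" for v
  have cxx: "cinner x x \<noteq> 0" using x0 by (simp add: cinner_self)
  have \<phi>: "A v = \<phi> v *\<^sub>C x" for v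
    using x[of v] cxx by (auto simp: \<phi>_def cinner_scaleC_left)
  have add: "\<phi> (u + v) = \<phi> u + \<phi> v" for u v
    by (simp add: \<phi>_def bop_add[OF assms(1)] cinner_add_left add_divide_distrib)
  have scale: "\<phi> (c *\<^sub>C u) = c * \<phi> u" for c u
    by (simp add: \<phi>_def bop_scaleC[OF assms(1)] cinner_scaleC_left)
  have bound: "cmod (\<phi> u) \<le> norm u * (onorm A / norm x)" for u
  proof -
    have "norm (A u) \<le> onorm A * norm u" by (rule onorm[OF bop_bounded_linear[OF assms(1)]])
    then have "cmod (\<phi> u) * norm x \<le> onorm A * norm u" by (simp only: \<phi>[of u] norm_scaleC)
    then show ?thesis using x0 by (simp add: field_simps)
  qed
  obtain y where y: "\<And>v. \<phi> v = cinner v y"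
    using Riesz_representation[OF add scale bound] by blast
  have A: "A = (\<lambda>v. cinner v y *\<^sub>C x)" using \<phi> y by auto
  then have "y \<noteq> 0" using A0 rank_one_eq_0_iff[of y x] by auto
  then show ?thesis using that x0 A by blast
qed

lemma rank_one_comp:
  fixes x y z w :: "'a::complex_inner"
  shows "(\<lambda>v. cinner v y *\<^sub>C x) \<circ> (\<lambda>v. cinner v z *\<^sub>C w)
    = (\<lambda>v. cinner v z *\<^sub>C (cinner w y *\<^sub>C x))"
  by (auto simp: cinner_scaleC_left scaleC_scaleC)

section \<open>The norm induced by a symmetric norm\<close>

abbreviation svec :: "nat \<Rightarrow> ('a::complex_inner \<Rightarrow> 'a) \<Rightarrow> nat \<Rightarrow> real" where
  "svec n A \<equiv> (\<lambda>i. if i < n then sval (Suc i) A else 0)"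

abbreviation unit_vec0 :: "nat \<Rightarrow> real" where
  "unit_vec0 \<equiv> (\<lambda>i. if i = 0 then 1 else 0)"

lemma svec_in_Rn: "svec n A \<in> Rn n"
  by (simp add: Rn_def)

lemma unit_vec0_in_Rn: "1 \<le> n \<Longrightarrow> unit_vec0 \<in> Rn n"
  by (simp add: Rn_def)

text \<open>A rank one operator is its own competitor from the second singular value on, so its
  vector of singular values is a multiple of \<open>unit_vec0\<close>.\<close>

lemma snorm_rank_one:
  assumes "symmetric_norm n f" "1 \<le> n" "bop A" "crank A = 1"
  shows "snorm n f A = onorm A * f unit_vec0"
proof -
  have "sval (Suc i) A = 0" if "i \<noteq> 0" for i
    using that assms(3,4) by (intro sval_eq_0) (auto simp: one_enat_def)
  then have "svec n A = (\<lambda>i. onorm A * unit_vec0 i)"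
    using assms(2) sval_1[OF assms(3)] by auto
  then have "snorm n f A = \<bar>onorm A\<bar> * f unit_vec0"
    unfolding snorm_def using symmetric_norm_scale[OF assms(1) unit_vec0_in_Rn[OF assms(2)]] by simp
  then show ?thesis using onorm_pos_le[OF bop_bounded_linear[OF assms(3)]] by simp
qed

lemma snorm_ge_onorm:
  assumes "symmetric_norm n f" "1 \<le> n" "bop A"
  shows "onorm A * f unit_vec0 \<le> snorm n f A"
proof -
  have "f (\<lambda>i. onorm A * unit_vec0 i) \<le> snorm n f A"
    unfolding snorm_def
  proof (rule symmetric_norm_mono[OF assms(1) Rn_scale[OF unit_vec0_in_Rn[OF assms(2)]] svec_in_Rn])
    fix i
    show "\<bar>onorm A * unit_vec0 i\<bar> \<le> \<bar>svec n A i\<bar>" using assms(2) sval_1[OF assms(3)] by auto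
  qed
  then show ?thesis
    using symmetric_norm_scale[OF assms(1) unit_vec0_in_Rn[OF assms(2)], of "onorm A"]
      onorm_pos_le[OF bop_bounded_linear[OF assms(3)]] by simp
qed

lemma snorm_le_scaled:
  assumes "symmetric_norm n f" "bop T" "0 \<le> c" "\<And>k. sval (Suc k) T \<le> c * sval (Suc k) A"
  shows "snorm n f T \<le> c * snorm n f A"
proof -
  have "f (svec n T) \<le> f (\<lambda>i. c * svec n A i)"
  proof (rule symmetric_norm_mono[OF assms(1) svec_in_Rn Rn_scale[OF svec_in_Rn]])
    fix i
    show "\<bar>svec n T i\<bar> \<le> \<bar>c * svec n A i\<bar>"
      using assms(4)[of i] sval_nonneg[OF assms(2), of i] by auto
  qed
  then show ?thesis
    unfolding snorm_def symmetric_norm_scale[OF assms(1) svec_in_Rn] using assms(3) by simp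
qed

text \<open>The first singular value of \<open>T\<close> is its largest, so
  \<open>symmetric_norm_strict_mono_largest\<close> applies.\<close>

lemma snorm_less_scaled:
  assumes "symmetric_norm n f" "1 \<le> n" "bop T" "0 \<le> c" "\<And>k. sval (Suc k) T \<le> c * sval (Suc k) A"
    and "sval (Suc 0) T < c * sval (Suc 0) A"
  shows "snorm n f T < c * snorm n f A"
proof -
  have "f (svec n T) < f (\<lambda>i. c * svec n A i)"
  proof (rule symmetric_norm_strict_mono_largest[OF assms(1) _ svec_in_Rn Rn_scale[OF svec_in_Rn]])
    show "0 < n" using assms(2) by simp
    show "0 \<le> svec n T i" for i using sval_nonneg[OF assms(3)] by simp
    show "svec n T i \<le> svec n T 0" for i
      using sval_le_onorm[OF assms(3), of i] sval_nonneg[OF assms(3), of 0] sval_1[OF assms(3)] by auto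
    show "svec n T i \<le> c * svec n A i" for i using assms(5) by auto
    show "svec n T 0 < c * svec n A 0" using assms(2,6) by auto
  qed
  then show ?thesis
    unfolding snorm_def symmetric_norm_scale[OF assms(1) svec_in_Rn] using assms(4) by simp
qed

lemma snorm_pos:
  assumes "symmetric_norm n f" "1 \<le> n" "bop A" "A \<noteq> (\<lambda>_. 0)"
  shows "0 < snorm n f A"
proof -
  have "unit_vec0 \<noteq> (\<lambda>_. 0)" by (auto dest: fun_cong[of _ _ 0])
  then have "0 < f unit_vec0"
    using symmetric_norm_nonneg[OF assms(1) unit_vec0_in_Rn[OF assms(2)]]
      symmetric_norm_eq_0_iff[OF assms(1) unit_vec0_in_Rn[OF assms(2)]] by linarith
  then have "0 < onorm A * f unit_vec0" using onorm_bop_pos[OF assms(3,4)] by simp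
  then show ?thesis using snorm_ge_onorm[OF assms(1-3)] by linarith
qed

text \<open>Bounding the norm of the product by \<open>onorm A * snorm n f B\<close>, and by the
  mirror expression, leaves a positive factor to cancel.\<close>

lemma snorm_mult_eq_imp_le:
  assumes "symmetric_norm n f" "1 \<le> n" "bop A" "bop B" "A \<noteq> (\<lambda>_. 0)" "B \<noteq> (\<lambda>_. 0)"
    and eq: "snorm n f (A \<circ> B) = snorm n f A * snorm n f B"
  shows "snorm n f A \<le> onorm A" "snorm n f B \<le> onorm B"
proof -
  have "snorm n f (A \<circ> B) \<le> onorm A * snorm n f B"
    by (intro snorm_le_scaled assms bop_comp sval_comp_left onorm_pos_le bop_bounded_linear)
  then show "snorm n f A \<le> onorm A"
    using snorm_pos[OF assms(1,2,4,6)] unfolding eq by simp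
  have "snorm n f (A \<circ> B) \<le> onorm B * snorm n f A"
    by (intro snorm_le_scaled assms bop_comp sval_comp_right onorm_pos_le bop_bounded_linear)
  then show "snorm n f B \<le> onorm B"
    using snorm_pos[OF assms(1,2,3,5)] unfolding eq by (simp add: mult.commute)
qed

theorem theorem2p6:
  fixes n :: nat and f :: "(nat \<Rightarrow> real) \<Rightarrow> real"
  assumes n_pos: "n \<ge> 1"
    and sym: "symmetric_norm n f"
    and dimH: "\<exists>S::'a::chilbert set. finite S \<and> card S = n \<and> cindependent S"
    and submult: "\<forall>A B::'a \<Rightarrow> 'a. bop A \<longrightarrow> bop B \<longrightarrow>
                    snorm n f (A \<circ> B) \<le> snorm n f A * snorm n f B"
  shows "((\<exists>A B::'a \<Rightarrow> 'a. bop A \<and> bop B \<and> A \<noteq> (\<lambda>_. 0) \<and> B \<noteq> (\<lambda>_. 0) \<and>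
             snorm n f (A \<circ> B) = snorm n f A * snorm n f B)
          \<longleftrightarrow> (\<forall>A::'a \<Rightarrow> 'a. bop A \<and> crank A = 1 \<longrightarrow> snorm n f A = sval 1 A))
       \<and> ((\<forall>A::'a \<Rightarrow> 'a. bop A \<and> crank A = 1 \<longrightarrow> snorm n f A = sval 1 A) \<longrightarrow>
            (\<forall>A B::'a \<Rightarrow> 'a. bop A \<and> bop B \<and> A \<noteq> (\<lambda>_. 0) \<and> B \<noteq> (\<lambda>_. 0) \<longrightarrow>
               (snorm n f (A \<circ> B) = snorm n f A * snorm n f B
                \<longleftrightarrow> sval 1 (A \<circ> B) = snorm n f A * snorm n f B))
          \<and> ((\<forall>T::'a \<Rightarrow> 'a. bop T \<and> T \<noteq> (\<lambda>_. 0) \<and> snorm n f T = sval 1 T \<longrightarrow> crank T = 1) \<longrightarrow>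
            (\<forall>A B::'a \<Rightarrow> 'a. bop A \<and> bop B \<and> A \<noteq> (\<lambda>_. 0) \<and> B \<noteq> (\<lambda>_. 0) \<longrightarrow>
               (snorm n f (A \<circ> B) = snorm n f A * snorm n f B
                \<longleftrightarrow> (\<exists>x y z::'a. x \<noteq> 0 \<and> y \<noteq> 0 \<and> z \<noteq> 0 \<and> cinner y y = 1 \<and>
                        A = (\<lambda>v. cinner v y *\<^sub>C x) \<and> B = (\<lambda>v. cinner v z *\<^sub>C y))))))"
proof -
  let ?\<mu> = "f unit_vec0"
  let ?cross = "\<forall>A::'a \<Rightarrow> 'a. bop A \<and> crank A = 1 \<longrightarrow> snorm n f A = sval 1 A"
  have s1: "sval 1 A = onorm A" if "bop A" for A :: "'a \<Rightarrow> 'a"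
    using sval_1[OF that] by simp
  have ge: "onorm A * ?\<mu> \<le> snorm n f A" if "bop A" for A :: "'a \<Rightarrow> 'a"
    using snorm_ge_onorm[OF sym n_pos that] .
  \<comment> \<open>The dimension hypothesis provides a nonzero vector: \<open>S\<close> is nonempty
    as \<open>n \<ge> 1\<close>, and independence excludes 0.\<close>
  obtain S :: "'a set" where S: "finite S" "card S = n" "cindependent S" using dimH by blast
  obtain s where s: "s \<in> S" using S n_pos by fastforce
  have "s \<noteq> 0"
  proof
    assume "s = 0"
    have "(\<Sum>t\<in>S. (if t = s then 1 else 0) *\<^sub>C t) = 0"
      using \<open>s = 0\<close> by (intro sum.neutral) auto
    then show False using S(3) s unfolding cindependent_def
      by (auto dest!: spec[of _ "\<lambda>t. if t = s then 1 else 0"])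
  qed
  define e where "e = complex_of_real (inverse (norm s)) *\<^sub>C s"
  have e: "norm e = 1" using \<open>s \<noteq> 0\<close> by (simp add: e_def norm_normalize del: of_real_inverse)
  then have e0: "e \<noteq> 0" by auto
  \<comment> \<open>An idempotent of rank one and operator norm 1: submultiplicativity at
    \<open>P \<circ> P = P\<close> gives \<open>?\<mu> \<le> ?\<mu> * ?\<mu>\<close>, and
    \<open>P\<close> later serves as the example of equality.\<close>
  define P where "P = (\<lambda>v. cinner v e *\<^sub>C e)"
  have P: "bop P" "crank P = 1" "onorm P = 1" "P \<noteq> (\<lambda>_. 0)"
    unfolding P_def using bop_rank_one crank_rank_one[OF e0 e0] onorm_rank_one[of e e] e
      rank_one_eq_0_iff[of e e] e0 by auto
  have PP: "P \<circ> P = P"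
    unfolding P_def rank_one_comp using e by (simp add: cinner_self scaleC_one)
  have nP: "snorm n f P = ?\<mu>" using snorm_rank_one[OF sym n_pos P(1,2)] P(3) by simp
  have "?\<mu> \<le> ?\<mu> * ?\<mu>" using submult[rule_format, OF P(1) P(1)] PP nP by simp
  moreover have "0 < ?\<mu>" using snorm_pos[OF sym n_pos P(1,4)] nP by simp
  ultimately have mu_ge: "1 \<le> ?\<mu>" by simp
  \<comment> \<open>Rank one operators have norm \<open>?\<mu>\<close> times their operator norm;
    \<open>P\<close> tests the forward direction.\<close>
  have cross_iff: "?cross \<longleftrightarrow> ?\<mu> = 1"
    using nP P s1 snorm_rank_one[OF sym n_pos] by (metis mult.right_neutral)
  have mu: "?\<mu> = 1"
    if "bop A" "bop B" "A \<noteq> (\<lambda>_. 0)" "B \<noteq> (\<lambda>_. 0)"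
      "snorm n f (A \<circ> B) = snorm n f A * snorm n f B" for A B :: "'a \<Rightarrow> 'a"
  proof -
    \<comment> \<open>\<open>snorm n f A\<close> lies between \<open>onorm A * ?\<mu>\<close> and
      \<open>onorm A\<close>.\<close>
    have "onorm A * ?\<mu> \<le> onorm A * 1"
      using ge[OF that(1)] snorm_mult_eq_imp_le(1)[OF sym n_pos that] by linarith
    then show ?thesis using onorm_bop_pos[OF that(1,3)] mu_ge by simp
  qed
  have part0: "(\<exists>A B::'a \<Rightarrow> 'a. bop A \<and> bop B \<and> A \<noteq> (\<lambda>_. 0) \<and> B \<noteq> (\<lambda>_. 0) \<and>
      snorm n f (A \<circ> B) = snorm n f A * snorm n f B) \<longleftrightarrow> ?cross" (is "?ex \<longleftrightarrow> _")
  proof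
    assume ?ex
    then show ?cross unfolding cross_iff using mu by blast
  next
    assume ?cross
    then have "snorm n f (P \<circ> P) = snorm n f P * snorm n f P"
      using PP nP cross_iff by simp
    then show ?ex using P by blast
  qed
  have norm_eq: "snorm n f A = onorm A \<and> snorm n f B = onorm B \<and>
      onorm (A \<circ> B) = snorm n f A * snorm n f B"
    if AB: "bop A" "bop B" "A \<noteq> (\<lambda>_. 0)" "B \<noteq> (\<lambda>_. 0)"
      "snorm n f (A \<circ> B) = snorm n f A * snorm n f B" for A B :: "'a \<Rightarrow> 'a"
  proof -
    have a: "snorm n f A = onorm A" and b: "snorm n f B = onorm B"
      using ge[OF AB(1)] ge[OF AB(2)] snorm_mult_eq_imp_le[OF sym n_pos AB] mu[OF AB] by simp_all
    have le: "onorm (A \<circ> B) \<le> onorm A * onorm B"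
      using AB by (intro onorm_compose bop_bounded_linear)
    \<comment> \<open>A strict drop in the first singular value would make the norm of the product
      strictly smaller than \<open>onorm B * snorm n f A\<close>, which is the product of the
      norms.\<close>
    have "\<not> onorm (A \<circ> B) < onorm A * onorm B"
    proof
      assume "onorm (A \<circ> B) < onorm A * onorm B"
      then have "snorm n f (A \<circ> B) < onorm B * snorm n f A"
        using AB by (intro snorm_less_scaled[OF sym n_pos] bop_comp sval_comp_right onorm_pos_le
            bop_bounded_linear) (auto simp: sval_1 bop_comp mult.commute)
      then show False using AB(5) b by (simp add: mult.commute)
    qed
    then show ?thesis using a b le by simp
  qed
  have part1: "snorm n f (A \<circ> B) = snorm n f A * snorm n f B
      \<longleftrightarrow> sval 1 (A \<circ> B) = snorm n f A * snorm n f B"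
    if cross: ?cross and AB: "bop A" "bop B" "A \<noteq> (\<lambda>_. 0)" "B \<noteq> (\<lambda>_. 0)" for A B :: "'a \<Rightarrow> 'a"
  proof
    assume "snorm n f (A \<circ> B) = snorm n f A * snorm n f B"
    then show "sval 1 (A \<circ> B) = snorm n f A * snorm n f B"
      using norm_eq AB s1 bop_comp by metis
  next
    assume "sval 1 (A \<circ> B) = snorm n f A * snorm n f B"
    \<comment> \<open>With submultiplicativity, this squeezes \<open>snorm n f (A \<circ> B)\<close>
      between equal bounds.\<close>
    moreover have "sval 1 (A \<circ> B) \<le> snorm n f (A \<circ> B)"
      using ge[OF bop_comp[OF AB(1,2)]] cross cross_iff s1[OF bop_comp[OF AB(1,2)]] by simp
    ultimately show "snorm n f (A \<circ> B) = snorm n f A * snorm n f B"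
      using submult[rule_format, OF AB(1,2)] by simp
  qed
  have part2: "snorm n f (A \<circ> B) = snorm n f A * snorm n f B
      \<longleftrightarrow> (\<exists>x y z::'a. x \<noteq> 0 \<and> y \<noteq> 0 \<and> z \<noteq> 0 \<and> cinner y y = 1 \<and>
             A = (\<lambda>v. cinner v y *\<^sub>C x) \<and> B = (\<lambda>v. cinner v z *\<^sub>C y))" (is "?eq \<longleftrightarrow> ?form")
    if cross: ?cross
      and rk: "\<forall>T::'a \<Rightarrow> 'a. bop T \<and> T \<noteq> (\<lambda>_. 0) \<and> snorm n f T = sval 1 T \<longrightarrow> crank T = 1"
      and AB: "bop A" "bop B" "A \<noteq> (\<lambda>_. 0)" "B \<noteq> (\<lambda>_. 0)" for A B :: "'a \<Rightarrow> 'a"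
  proof
    assume ?eq
    note N = norm_eq[OF AB this]
    have "crank A = 1" "crank B = 1" using rk AB N s1 by simp_all
    obtain x' y' where A: "x' \<noteq> 0" "y' \<noteq> 0" "A = (\<lambda>v. cinner v y' *\<^sub>C x')"
      using crank_1_obtain[OF AB(1) \<open>crank A = 1\<close>] .
    obtain w z' where B: "w \<noteq> 0" "z' \<noteq> 0" "B = (\<lambda>v. cinner v z' *\<^sub>C w)"
      using crank_1_obtain[OF AB(2) \<open>crank B = 1\<close>] .
    \<comment> \<open>Both sides are operator norms of rank one operators; cancelling
      \<open>norm x'\<close> and \<open>norm z'\<close> leaves equality in Cauchy-Schwarz.\<close>
    have "cmod (cinner w y') * norm x' * norm z' = (norm x' * norm y') * (norm w * norm z')"
      using N unfolding A(3) B(3) rank_one_comp onorm_rank_one norm_scaleC by simp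
    then have cs: "cmod (cinner w y') = norm w * norm y'" using A B by (simp add: mult_ac)
    \<comment> \<open>Rescaling to a common unit vector: \<open>x\<close> takes over the length of
      \<open>y'\<close>, and \<open>z\<close> takes over the factor in
      \<open>w = cinner w y *\<^sub>C y\<close>, conjugated because \<open>cinner\<close> is
      conjugate-linear in its second argument.\<close>
    define y where "y = complex_of_real (inverse (norm y')) *\<^sub>C y'"
    define x where "x = complex_of_real (norm y') *\<^sub>C x'"
    define z where "z = cnj (cinner w y) *\<^sub>C z'"
    have y: "norm y = 1" using A by (simp add: y_def norm_normalize del: of_real_inverse)
    have "cmod (cinner w y) = norm w" using cs A by (simp add: y_def cinner_scaleC_right norm_mult norm_inverse)
    then have w: "w = cinner w y *\<^sub>C y" using cinner_Cauchy_Schwarz_eq y by blast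
    have "A = (\<lambda>v. cinner v y *\<^sub>C x)"
      using A by (simp add: y_def x_def cinner_scaleC_right scaleC_scaleC field_simps)
    moreover have "B = (\<lambda>v. cinner v z *\<^sub>C y)"
    proof
      fix v
      have "B v = cinner v z' *\<^sub>C (cinner w y *\<^sub>C y)" using B(3) w by simp
      then show "B v = cinner v z *\<^sub>C y"
        by (simp add: z_def cinner_scaleC_right scaleC_scaleC mult.commute)
    qed
    moreover have "x \<noteq> 0" using A by (simp add: x_def scaleC_eq_0_iff)
    moreover have "y \<noteq> 0" using y by auto
    moreover have "z \<noteq> 0"
      \<comment> \<open>A vanishing \<open>cinner w y\<close> would give
        \<open>w = 0\<close>.\<close>
      using B w by (auto simp: z_def scaleC_eq_0_iff)
    moreover have "cinner y y = 1" using y by (simp add: cinner_self)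
    ultimately show ?form by blast
  next
    assume ?form
    then obtain x y z where xyz: "x \<noteq> 0" "y \<noteq> 0" "z \<noteq> 0" "cinner y y = 1"
      "A = (\<lambda>v. cinner v y *\<^sub>C x)" "B = (\<lambda>v. cinner v z *\<^sub>C y)" by blast
    have y: "norm y = 1"
    proof -
      have "complex_of_real ((norm y)\<^sup>2) = complex_of_real 1" using xyz(4) cinner_self[of y] by simp
      then have "(norm y)\<^sup>2 = 1" using of_real_eq_iff by blast
      then show ?thesis using norm_ge_zero[of y] unfolding power2_eq_1_iff by linarith
    qed
    have comp: "A \<circ> B = (\<lambda>v. cinner v z *\<^sub>C x)"
      unfolding xyz(5,6) rank_one_comp xyz(4) scaleC_one ..
    \<comment> \<open>By the cross property both sides of the goal reduce to
      \<open>norm x * norm z\<close>, as \<open>y\<close> is a unit vector.\<close>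
    have "snorm n f (\<lambda>v. cinner v b *\<^sub>C a) = norm a * norm b" if "a \<noteq> 0" "b \<noteq> 0" for a b :: 'a
      using cross s1 bop_rank_one[of b a] crank_rank_one[OF that] onorm_rank_one[of b a] by simp
    then show ?eq unfolding comp unfolding xyz(5,6) using xyz y by simp
  qed
  show ?thesis
    by (intro conjI impI allI; (elim conjE)?; (rule part0 | rule part1 | rule part2); assumption)
qed

end
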